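(* Let $(u_n)_{n\geq 1}$ be a sequence in which every nonzero ZF-word appears exactly once, and which is length-increasing, i.e. the position (counted from the right) of the leftmost $1$ of $u_n$ is nondecreasing in $n$. Then for every $n\geq 1$, $h(u_n,u_{n+1})\geq h(g_n,g_{n+1})$, where $(g_n)$ is the list defined below.
   Context: A ZF-word is a binary word with no two consecutive $1$s; words differing only by leading zeros are identified, and a word is nonzero if it contains a $1$. For a list $\mathcal{L}$ of words: $w\mathcal{L}$ prefixes $w$ to each element; $\mathcal{L}'$ removes the leftmost letter of each element; $\overline{\mathcal{L}}$ is the list reversed; $+$ is concatenation of lists. Define $\mathcal{N}_0=\varnothing$, $\mathcal{N}_1=(1)$, and for $n\geq 2$, $\mathcal{N}_n=10\overline{\mathcal{N}_{n-1}'}+10\overline{\mathcal{N}_{n-2}}$; let $(g_1,g_2,\dots)=\mathcal{N}_1+\mathcal{N}_2+\cdots$. The Hamming distance $h(w,w')$ is the number of positions where $w,w'$ differ after padding the shorter word with leading zeros. *)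

theory Defs imports Main begin

text \<open>
  A binary word is a list of letters read from left to right, with \<open>False\<close> for \<open>0\<close>
  and \<open>True\<close> for \<open>1\<close>.
\<close>

type_synonym word = "bool list"

definition zf_word :: "word \<Rightarrow> bool" where
  "zf_word w \<longleftrightarrow> (\<forall>i. Suc i < length w \<longrightarrow> \<not> (w ! i \<and> w ! Suc i))"

definition nonzero_word :: "word \<Rightarrow> bool" where
  "nonzero_word w \<longleftrightarrow> True \<in> set w"

text \<open>
  Words are not normalised; the identification of words differing only by leading zeros
  is the following equivalence relation. The notions above, and the leading position and
  Hamming distance below, respect it.
\<close>

definition same_word :: "word \<Rightarrow> word \<Rightarrow> bool" where
  "same_word v w \<longleftrightarrow> (\<exists>k l. replicate k False @ v = replicate l False @ w)"

text \<open>
  Positions are counted from the right starting with \<open>1\<close>, so that the letter \<open>w ! i\<close>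
  has position \<open>length w - i\<close>. Only meaningful for nonzero words.
\<close>

definition leading_pos :: "word \<Rightarrow> nat" where
  "leading_pos w = length w - (LEAST i. i < length w \<and> w ! i)"

definition pad :: "nat \<Rightarrow> word \<Rightarrow> word" where
  "pad m w = replicate (m - length w) False @ w"

definition hamming :: "word \<Rightarrow> word \<Rightarrow> nat" where
  "hamming v w = (let m = max (length v) (length w)
                  in card {i. i < m \<and> pad m v ! i \<noteq> pad m w ! i})"

definition prefix_all :: "word \<Rightarrow> word list \<Rightarrow> word list" where
  "prefix_all w L = map (\<lambda>v. w @ v) L"

definition remove_leftmost :: "word list \<Rightarrow> word list" where
  "remove_leftmost L = map tl L"

fun NN :: "nat \<Rightarrow> word list" where
  "NN 0 = []"
| "NN (Suc 0) = [[True]]"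
| "NN (Suc (Suc n)) =
     prefix_all [True, False] (rev (remove_leftmost (NN (Suc n))))
     @ prefix_all [True, False] (rev (NN n))"

text \<open>
  The infinite concatenation \<open>NN 1 + NN 2 + \<dots>\<close>, indexed from \<open>1\<close> (\<open>gg 0\<close> is junk). Since
  \<open>NN k\<close> is nonempty for \<open>k \<ge> 1\<close>, the first \<open>n\<close> lists contain at least \<open>n\<close> words; by
  \<open>gg_eq\<close> any other sufficiently long finite part gives the same word.
\<close>

definition gg :: "nat \<Rightarrow> word" where
  "gg n = concat (map NN [1..<Suc n]) ! (n - 1)"

lemma NN_nonempty: "k \<ge> 1 \<Longrightarrow> NN k \<noteq> []"
  by (induction k rule: NN.induct) (auto simp: prefix_all_def remove_leftmost_def)

lemma length_concat_NN: "n \<le> length (concat (map NN [1..<Suc n]))"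
proof (induction n)
  case (Suc n)
  have "1 \<le> length (NN (Suc n))"
    using NN_nonempty[of "Suc n"] by (simp add: Suc_le_eq del: NN.simps)
  with Suc show ?case
    by (simp del: NN.simps)
qed simp

lemma concat_NN_nth:
  assumes "m \<le> p" "i < length (concat (map NN [1..<Suc m]))"
  shows "concat (map NN [1..<Suc p]) ! i = concat (map NN [1..<Suc m]) ! i"
proof -
  have "[1..<Suc p] = [1..<Suc m] @ [Suc m..<Suc p]"
    using assms(1) upt_add_eq_append[of 1 "Suc m" "p - m"] by simp
  with assms(2) show ?thesis
    by (simp add: nth_append del: upt_Suc NN.simps)
qed

lemma gg_eq:
  assumes "n \<ge> 1" "n \<le> length (concat (map NN [1..<Suc m]))"
  shows "gg n = concat (map NN [1..<Suc m]) ! (n - 1)"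
proof (cases "m \<le> n")
  case True
  with assms show ?thesis
    unfolding gg_def by (intro concat_NN_nth) simp_all
next
  case False
  with assms length_concat_NN[of n] show ?thesis
    unfolding gg_def by (intro concat_NN_nth[symmetric]) linarith+
qed

end

theory Submission imports Defs begin

text \<open>
  Within each \<open>NN k\<close> consecutive words differ in one letter, and the last word \<open>1x\<close> of \<open>NN k\<close> is
  followed by \<open>10x\<close>, at distance two. In a length-increasing list \<open>u\<close> the words of a given length
  occupy the same indices as in \<open>gg\<close>, by counting. Distinct words have distance at least one, and
  when the length grows by one, the ZF condition forces two differences: the new leading \<open>1\<close>, and
  the \<open>0\<close> after it, which meets the leading \<open>1\<close> of the shorter word.
\<close>

section \<open>Letters and distances\<close>

definition bit_at :: "word \<Rightarrow> nat \<Rightarrow> bool" where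
  "bit_at w j \<longleftrightarrow> j < length w \<and> rev w ! j"

lemma bit_at_Cons: "bit_at (a # w) j \<longleftrightarrow> (if j = length w then a else bit_at w j)"
  by (auto simp: bit_at_def nth_append less_Suc_eq)

lemma not_bit_at: "length w \<le> j \<Longrightarrow> \<not> bit_at w j"
  by (simp add: bit_at_def)

lemma bit_at_dropWhile: "bit_at (dropWhile Not w) j = bit_at w j"
  by (induction w) (auto simp: bit_at_Cons not_bit_at)

lemma finite_bit_diff: "finite {j. bit_at v j \<noteq> bit_at w j}"
  by (rule finite_subset[of _ "{..<max (length v) (length w)}"]) (auto simp: bit_at_def)

lemma nth_pad:
  assumes "length w \<le> m" "i < m"
  shows "pad m w ! i \<longleftrightarrow> bit_at w (m - 1 - i)"
proof (cases "i < m - length w")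
  case False
  then have "i - (m - length w) = length w - Suc (m - 1 - i)" "m - 1 - i < length w"
    using assms by auto
  then show ?thesis
    using False by (simp add: pad_def bit_at_def nth_append rev_nth)
next
  case True
  then have "length w \<le> m - 1 - i"
    by linarith
  then show ?thesis
    using True by (simp add: pad_def nth_append not_bit_at del: diff_Suc_1)
qed

text \<open>The reflection of indices below \<open>m\<close>, which is its own inverse, turns left
  indices of padded words into positions from the right. The common length \<open>m\<close> then
  disappears.\<close>

lemma hamming_bit: "hamming v w = card {j. bit_at v j \<noteq> bit_at w j}"
proof -
  define m where "m = max (length v) (length w)"
  have less: "j < m" if "bit_at v j \<noteq> bit_at w j" for j
    using that by (auto simp: bit_at_def m_def)
  have eq: "pad m v ! i \<noteq> pad m w ! i \<longleftrightarrow> bit_at v (m - 1 - i) \<noteq> bit_at w (m - 1 - i)"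
    if "i < m" for i
    using that by (simp add: nth_pad m_def)
  have "bij_betw (\<lambda>i. m - 1 - i) {i. i < m \<and> pad m v ! i \<noteq> pad m w ! i}
          {j. bit_at v j \<noteq> bit_at w j}"
  proof (rule bij_betw_byWitness[where f' = "\<lambda>i. m - 1 - i"])
    show "\<forall>j\<in>{j. bit_at v j \<noteq> bit_at w j}. m - 1 - (m - 1 - j) = j"
      using less by fastforce
    show "(\<lambda>i. m - 1 - i) ` {i. i < m \<and> pad m v ! i \<noteq> pad m w ! i}
        \<subseteq> {j. bit_at v j \<noteq> bit_at w j}"
      using eq by auto
    show "(\<lambda>i. m - 1 - i) ` {j. bit_at v j \<noteq> bit_at w j}
        \<subseteq> {i. i < m \<and> pad m v ! i \<noteq> pad m w ! i}"
    proof clarify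
      fix j assume j: "bit_at v j \<noteq> bit_at w j"
      then have "m - 1 - j < m" "m - 1 - (m - 1 - j) = j"
        using less[OF j] by auto
      then show "m - 1 - j < m \<and> pad m v ! (m - 1 - j) \<noteq> pad m w ! (m - 1 - j)"
        using j eq by metis
    qed
  qed auto
  then show ?thesis
    by (auto simp: hamming_def m_def Let_def dest: bij_betw_same_card)
qed

lemma hamming_commute: "hamming v w = hamming w v"
  unfolding hamming_bit by (rule arg_cong[where f = card]) auto

lemma hamming_Cons: "length v = length w \<Longrightarrow> hamming (a # v) (a # w) = hamming v w"
  unfolding hamming_bit
  by (rule arg_cong[where f = card]) (auto simp: bit_at_Cons not_bit_at)

lemma hamming_Cons_le: "hamming (a # w) (b # w) \<le> 1"
proof -
  have "{j. bit_at (a # w) j \<noteq> bit_at (b # w) j} \<subseteq> {length w}"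
    by (auto simp: bit_at_Cons split: if_splits)
  from card_mono[OF _ this] show ?thesis
    by (simp add: hamming_bit)
qed

text \<open>This is the passage from the last word of one list \<open>NN k\<close> to the first word
  of the next.\<close>

lemma hamming_shift_le: "hamming (True # w) (True # False # w) \<le> 2"
proof -
  have "{j. bit_at (True # w) j \<noteq> bit_at (True # False # w) j} \<subseteq> {length w, Suc (length w)}"
    by (auto simp: bit_at_Cons split: if_splits)
  from card_mono[OF _ this] show ?thesis
    by (simp add: hamming_bit)
qed

lemma same_word_if_hamming_0:
  assumes "hamming v w = 0"
  shows "same_word v w"
proof -
  define m where "m = max (length v) (length w)"
  have "pad m v = pad m w"
    using assms by (intro nth_equalityI) (auto simp: hamming_def Let_def pad_def m_def)
  then show ?thesis
    by (auto simp: same_word_def pad_def)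
qed

section \<open>Words without leading zeros\<close>

lemma zf_word_simps [simp]:
  "zf_word []" "zf_word [a]"
  "zf_word (a # b # w) \<longleftrightarrow> \<not> (a \<and> b) \<and> zf_word (b # w)"
  by (auto simp: zf_word_def less_Suc_eq_0_disj)

lemma zf_word_dropWhile: "zf_word w \<Longrightarrow> zf_word (dropWhile Not w)"
  by (induction w rule: induct_list012) auto

text \<open>These are the representatives without leading zeros of the nonzero ZF-words with leading
  position \<open>n\<close>. The conjunct \<open>w \<noteq> []\<close> avoids the unspecified
  \<open>hd []\<close>.\<close>

definition normal_words :: "nat \<Rightarrow> word set" where
  "normal_words n = {w. length w = n \<and> zf_word w \<and> w \<noteq> [] \<and> hd w}"

lemma normal_wordsE:
  assumes "w \<in> normal_words n"
  obtains x where "w = True # x" "n = Suc (length x)"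
  using assms by (cases w) (auto simp: normal_words_def)

lemma normal_words_tl: "w \<in> normal_words n \<Longrightarrow> True # tl w = w"
  by (cases w) (auto simp: normal_words_def)

lemma same_word_iff: "same_word v w \<longleftrightarrow> dropWhile Not v = dropWhile Not w"
proof
  have "dropWhile Not (replicate k False @ x) = dropWhile Not x" for k x
    by (induction k) auto
  then show "dropWhile Not v = dropWhile Not w" if "same_word v w"
    using that by (metis same_word_def)
  have *: "\<exists>k. x = replicate k False @ dropWhile Not x" for x
    by (induction x) (auto intro: exI[of _ 0] exI[of _ "Suc _"])
  \<comment> \<open>The zeros are exchanged crosswise: \<open>l\<close> more in front of
    \<open>v\<close> and \<open>k\<close> more in front of \<open>w\<close> give
    \<open>k + l\<close> zeros before the same normal form.\<close>
  obtain k l where "v = replicate k False @ dropWhile Not v" "w = replicate l False @ dropWhile Not w"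
    using *[of v] *[of w] by blast
  moreover assume "dropWhile Not v = dropWhile Not w"
  ultimately have "replicate l False @ v = replicate k False @ w"
    by (metis append.assoc replicate_add add.commute)
  then show "same_word v w"
    by (auto simp: same_word_def)
qed

lemma leading_pos_eq:
  assumes "nonzero_word w"
  shows "leading_pos w = length (dropWhile Not w)"
proof -
  have less: "length (takeWhile Not w) < length w"
    using assms
    by (metis dropWhile_eq_Nil_conv dropWhile_eq_drop drop_eq_Nil not_le nonzero_word_def)
  have "(LEAST i. i < length w \<and> w ! i) = length (takeWhile Not w)"
  proof (rule Least_equality)
    show "length (takeWhile Not w) < length w \<and> w ! length (takeWhile Not w)"
      using less nth_length_takeWhile[of Not w] by simp
    show "length (takeWhile Not w) \<le> i" if "i < length w \<and> w ! i" for i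
      using that by (metis not_le nth_mem set_takeWhileD takeWhile_nth)
  qed
  then show ?thesis
    by (simp add: leading_pos_def dropWhile_eq_drop)
qed

lemma dropWhile_normal:
  assumes "zf_word w" "nonzero_word w"
  shows "dropWhile Not w \<in> normal_words (leading_pos w)"
proof -
  have "dropWhile Not w \<noteq> []"
    using assms(2) by (auto simp: nonzero_word_def)
  then show ?thesis
    using assms hd_dropWhile[of Not w] by (auto simp: normal_words_def leading_pos_eq zf_word_dropWhile)
qed

lemma two_le_hamming:
  assumes "zf_word v" "nonzero_word v" "zf_word w" "nonzero_word w"
    and "leading_pos w = Suc (leading_pos v)"
  shows "2 \<le> hamming v w"
proof -
  obtain x where x: "dropWhile Not v = True # x" "leading_pos v = Suc (length x)"
    using dropWhile_normal[OF assms(1,2)] by (rule normal_wordsE)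
  obtain y where y: "dropWhile Not w = True # y" "leading_pos w = Suc (length y)"
    using dropWhile_normal[OF assms(3,4)] by (rule normal_wordsE)
  \<comment> \<open>The jump in position makes \<open>y\<close> one letter longer than
    \<open>x\<close>, hence nonempty, and its first letter follows a \<open>1\<close>.\<close>
  then obtain z where z: "y = False # z" "length z = length x"
    using zf_word_dropWhile[OF assms(3)] assms(5) x(2) by (cases y) auto
  \<comment> \<open>At \<open>Suc (length x)\<close> only \<open>w\<close> has a \<open>1\<close>;
    at \<open>length x\<close> the leading \<open>1\<close> of \<open>v\<close> meets the
    \<open>0\<close> in front of \<open>z\<close>.\<close>
  have "{length x, Suc (length x)} \<subseteq> {j. bit_at v j \<noteq> bit_at w j}"
    using z(2) by (auto simp: bit_at_dropWhile[of v, symmetric] bit_at_dropWhile[of w, symmetric]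
        x(1) y(1) z(1) bit_at_Cons not_bit_at)
  from card_mono[OF finite_bit_diff this] show ?thesis
    by (simp add: hamming_bit)
qed

section \<open>The lists \<open>NN\<close>\<close>

text \<open>The second letter must be \<open>0\<close>. If the rest \<open>y\<close> starts with
  \<open>1\<close>, it is itself a normal word of length \<open>n\<close>; otherwise
  \<open>1y\<close> is a normal word of length \<open>n + 1\<close>. These are the two summands in
  the recursion of \<open>NN\<close>.\<close>

lemma normal_words_Suc_Suc:
  "normal_words (Suc (Suc n)) =
    (@) [True, False] ` (tl ` normal_words (Suc n) \<union> normal_words n)"
proof (intro equalityI subsetI)
  fix w assume w: "w \<in> normal_words (Suc (Suc n))"
  then obtain y where y: "w = [True, False] @ y" "length y = n" "zf_word (False # y)"
    by (auto simp: normal_words_def length_Suc_conv)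
  have "y \<in> tl ` normal_words (Suc n) \<or> y \<in> normal_words n"
  proof (cases "y \<noteq> [] \<and> hd y")
    case False
    with y have "True # y \<in> normal_words (Suc n)"
      by (cases y) (auto simp: normal_words_def)
    then show ?thesis by force
  qed (use y in \<open>auto simp: normal_words_def neq_Nil_conv\<close>)
  with y(1) show "w \<in> (@) [True, False] ` (tl ` normal_words (Suc n) \<union> normal_words n)"
    by blast
next
  fix w assume "w \<in> (@) [True, False] ` (tl ` normal_words (Suc n) \<union> normal_words n)"
  then obtain y where y: "w = [True, False] @ y" "y \<in> tl ` normal_words (Suc n) \<union> normal_words n"
    by blast
  from y(2) have "True # y \<in> normal_words (Suc n) \<or> y \<in> normal_words n"
  proof
    assume "y \<in> tl ` normal_words (Suc n)"
    then obtain v where v: "y = tl v" "v \<in> normal_words (Suc n)"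
      by blast
    then show ?thesis
      by (simp add: normal_words_tl)
  qed simp
  with y(1) show "w \<in> normal_words (Suc (Suc n))"
    by (cases y) (auto simp: normal_words_def)
qed

lemma set_NN: "set (NN n) = normal_words n"
proof (induction n rule: NN.induct)
  case 2
  then show ?case by (auto simp: normal_words_def length_Suc_conv)
next
  case (3 n)
  then show ?case
    by (simp add: normal_words_Suc_Suc prefix_all_def remove_leftmost_def image_Un)
qed (simp add: normal_words_def)

lemma distinct_NN: "distinct (NN n)"
proof (induction n rule: NN.induct)
  case (3 n)
  have "inj_on tl (normal_words (Suc n))"
    by (rule inj_on_inverseI[where g = "(#) True"]) (rule normal_words_tl)
  \<comment> \<open>The two summands are disjoint: a common rest \<open>tl v\<close> would start
    with \<open>1\<close> directly after the leading \<open>1\<close> of \<open>v\<close>.\<close>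
  moreover have "False" if "v \<in> normal_words (Suc n)" "tl v \<in> normal_words n" for v
  proof -
    have "v = True # True # tl (tl v)"
      using normal_words_tl[OF that(1)] normal_words_tl[OF that(2)] by simp
    moreover have "zf_word v"
      using that(1) by (simp add: normal_words_def)
    ultimately show False
      by (metis zf_word_simps(3))
  qed
  ultimately show ?case
    using 3 by (auto simp: prefix_all_def remove_leftmost_def distinct_map set_NN inj_on_def)
qed auto

text \<open>The reversal in the first summand brings the last word of \<open>NN n\<close> to the
  front. This controls both the seam between the two summands of a list and the seam between
  consecutive lists.\<close>

lemma hd_NN_Suc:
  assumes "n \<ge> 1"
  shows "hd (NN (Suc n)) = True # False # tl (last (NN n))"
  using assms NN_nonempty[OF assms]
  by (cases n) (simp_all add: prefix_all_def remove_leftmost_def hd_append hd_map hd_rev last_map)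

lemma last_NN: "n \<ge> 1 \<Longrightarrow> last (NN n) = True # tl (last (NN n))"
  using normal_words_tl[of "last (NN n)" n] last_in_set[OF NN_nonempty[of n]]
  by (simp add: set_NN)

text \<open>Reversal, a common prefix and removal of the common leading \<open>1\<close> preserve
  distances, so only the seam between the two summands needs an argument.\<close>

lemma successively_NN: "successively (\<lambda>v w. hamming v w \<le> 1) (NN n)"
proof (induction n rule: NN.induct)
  case (3 n)
  let ?R = "\<lambda>v w. hamming v w \<le> 1"
  have prefix: "?R ([True, False] @ v) ([True, False] @ w)" if "?R v w" "length v = length w" for v w
    using that by (simp add: hamming_Cons)
  have first: "successively ?R (prefix_all [True, False] (rev (remove_leftmost (NN (Suc n)))))"
    unfolding prefix_all_def remove_leftmost_def successively_map successively_rev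
    by (rule successively_mono[OF "3.IH"(1)], unfold set_NN, elim normal_wordsE)
      (use prefix in \<open>simp add: hamming_Cons hamming_commute\<close>)
  have second: "successively ?R (prefix_all [True, False] (rev (NN n)))"
    unfolding prefix_all_def successively_map successively_rev
    by (rule successively_mono[OF "3.IH"(2)], unfold set_NN)
      (use prefix in \<open>simp add: normal_words_def hamming_commute\<close>)
  show ?case
  proof (cases "n = 0")
    case True
    then show ?thesis using first by (simp add: prefix_all_def)
  next
    case False
    then have n: "n \<ge> 1" by simp
    \<comment> \<open>After reversal the seam joins \<open>hd (NN (Suc n))\<close> without its
      leading \<open>1\<close> to \<open>last (NN n)\<close>. These differ at most in their first
      letter.\<close>
    have "?R (False # tl (last (NN n))) (last (NN n))"
      by (subst (2) last_NN[OF n]) (rule hamming_Cons_le)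
    moreover have "length (False # tl (last (NN n))) = length (last (NN n))"
      by (subst (2) last_NN[OF n]) simp
    ultimately have "?R ([True, False] @ tl (hd (NN (Suc n)))) ([True, False] @ last (NN n))"
      using prefix by (simp add: hd_NN_Suc[OF n] del: NN.simps)
    then show ?thesis
      using first second NN_nonempty[of n] NN_nonempty[of "Suc n"] n
      by (auto simp: successively_append_iff prefix_all_def remove_leftmost_def
          last_map hd_map hd_rev last_rev)
  qed
qed auto

section \<open>The sequence \<open>gg\<close>\<close>

definition NN_upto :: "nat \<Rightarrow> word list" where
  "NN_upto k = concat (map NN [1..<Suc k])"

lemma NN_upto_Suc: "NN_upto (Suc k) = NN_upto k @ NN (Suc k)"
  by (simp add: NN_upto_def del: NN.simps)

lemma set_NN_upto: "set (NN_upto k) = {w. zf_word w \<and> w \<noteq> [] \<and> hd w \<and> length w \<le> k}"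
  by (auto simp: NN_upto_def set_NN normal_words_def Suc_le_eq simp del: upt_Suc)

lemma distinct_NN_upto: "distinct (NN_upto k)"
proof (induction k)
  case (Suc k)
  then show ?case
    using distinct_NN[of "Suc k"]
    by (auto simp: NN_upto_Suc set_NN_upto set_NN normal_words_def simp del: NN.simps)
qed (simp add: NN_upto_def)

text \<open>Each bound is tied to the change in length because the lower bounds for \<open>u\<close>
  split in the same way.\<close>

definition gray_step :: "word \<Rightarrow> word \<Rightarrow> bool" where
  "gray_step v w \<longleftrightarrow> length w = length v \<and> hamming v w \<le> 1 \<or>
     length w = Suc (length v) \<and> hamming v w \<le> 2"

lemma successively_NN_upto: "successively gray_step (NN_upto k)"
proof (induction k)
  case (Suc k)
  have "successively gray_step (NN (Suc k))"
    by (rule successively_mono[OF successively_NN])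
      (auto simp: set_NN gray_step_def normal_words_def simp del: NN.simps)
  moreover have "gray_step (last (NN_upto k)) (hd (NN (Suc k)))" if "k \<ge> 1"
  proof -
    have "last (NN_upto k) = last (NN k)"
      using that NN_nonempty[OF that] by (cases k) (auto simp: NN_upto_Suc simp del: NN.simps)
    then show ?thesis
      using last_NN[OF that] hd_NN_Suc[OF that] hamming_shift_le[of "tl (last (NN k))"]
      by (metis gray_step_def length_Cons)
  qed
  \<comment> \<open>For \<open>k = 0\<close> nothing precedes \<open>NN 1\<close>, so there is no
    seam.\<close>
  moreover have "NN_upto k = []" if "\<not> k \<ge> 1"
    using that by (simp add: NN_upto_def)
  ultimately show ?case
    using Suc by (auto simp: NN_upto_Suc successively_append_iff simp del: NN.simps)
qed (simp add: NN_upto_def)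

lemma gray_step_gg:
  assumes "n \<ge> 1"
  shows "gray_step (gg n) (gg (Suc n))"
proof -
  have "gg n = NN_upto (Suc n) ! (n - 1)" "gg (Suc n) = NN_upto (Suc n) ! n"
    using assms length_concat_NN[of "Suc n"]
    by (auto simp: NN_upto_def gg_eq[of _ "Suc n"] simp del: NN.simps upt_Suc)
  moreover have "n < length (NN_upto (Suc n))"
    using length_concat_NN[of "Suc n"] by (simp add: NN_upto_def del: NN.simps upt_Suc)
  ultimately show ?thesis
    using assms successively_NN_upto[of "Suc n"] unfolding successively_conv_nth
    by (metis Suc_diff_1 less_le_trans zero_less_one)
qed

text \<open>\<open>NN_upto k\<close> is an initial segment of \<open>gg\<close> and holds exactly
  the normal words of length at most \<open>k\<close>. That such words do not recur later follows
  from distinctness of a longer segment.\<close>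

lemma length_gg_le_iff:
  assumes "n \<ge> 1"
  shows "length (gg n) \<le> k \<longleftrightarrow> n \<le> length (NN_upto k)"
proof
  assume "n \<le> length (NN_upto k)"
  then have "gg n = NN_upto k ! (n - 1)" "n - 1 < length (NN_upto k)"
    using assms gg_eq[of n k] by (auto simp: NN_upto_def simp del: NN.simps upt_Suc)
  then have "gg n \<in> set (NN_upto k)"
    by simp
  then show "length (gg n) \<le> k"
    by (simp add: set_NN_upto)
next
  have "gg n = NN_upto n ! (n - 1)" "n - 1 < length (NN_upto n)"
    using assms length_concat_NN[of n] by (auto simp: gg_def NN_upto_def simp del: NN.simps upt_Suc)
  then have "gg n \<in> set (NN_upto n)"
    by simp
  moreover assume "length (gg n) \<le> k"
  ultimately have "gg n \<in> set (NN_upto k)"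
    by (simp add: set_NN_upto)
  then obtain i where i: "i < length (NN_upto k)" "NN_upto k ! i = gg n"
    by (auto simp: in_set_conv_nth)
  \<comment> \<open>\<open>NN_upto p\<close> extends both segments, so the two occurrences of
    \<open>gg n\<close>, at \<open>i\<close> and at \<open>n - 1\<close>, can be compared in one
    distinct list.\<close>
  define p where "p = max n k"
  have "NN_upto p ! i = gg n"
    using i concat_NN_nth[of k p i] by (simp add: NN_upto_def p_def del: NN.simps upt_Suc)
  moreover have "NN_upto p ! (n - 1) = gg n"
    using assms concat_NN_nth[of n p "n - 1"] length_concat_NN[of n]
    by (simp add: NN_upto_def p_def gg_def del: NN.simps upt_Suc)
  moreover have "length (NN_upto k) \<le> length (NN_upto p)" "n \<le> length (NN_upto p)"
  proof -
    have "mono (\<lambda>k. length (NN_upto k))"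
      by (rule mono_iff_le_Suc[THEN iffD2]) (simp add: NN_upto_Suc del: NN.simps)
    then show "length (NN_upto k) \<le> length (NN_upto p)" "n \<le> length (NN_upto p)"
      using length_concat_NN[of n] monoD[of "\<lambda>k. length (NN_upto k)" _ p]
      by (auto simp: p_def NN_upto_def simp del: NN.simps upt_Suc intro: order_trans)
  qed
  ultimately have "i = n - 1"
    using i assms nth_eq_iff_index_eq[OF distinct_NN_upto[of p], of i "n - 1"] by simp
  then show "n \<le> length (NN_upto k)"
    using i by simp
qed

section \<open>Comparison of an arbitrary length-increasing sequence with \<open>gg\<close>\<close>

theorem theorem2p8:
  fixes u :: "nat \<Rightarrow> word"
  assumes terms: "\<And>n. n \<ge> 1 \<Longrightarrow> zf_word (u n) \<and> nonzero_word (u n)"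
    and once: "\<And>w. zf_word w \<Longrightarrow> nonzero_word w \<Longrightarrow> \<exists>!n. n \<ge> 1 \<and> same_word (u n) w"
    and length_increasing: "mono_on {1..} (\<lambda>n. leading_pos (u n))"
  shows "\<forall>n\<ge>1. hamming (u n) (u (Suc n)) \<ge> hamming (gg n) (gg (Suc n))"
proof (intro allI impI)
  have unique: "m = n" if "m \<ge> 1" "n \<ge> 1" "same_word (u m) (u n)" for m n
    using that once[of "u n"] terms[of n] by (auto simp: same_word_iff)
  \<comment> \<open>This is the counterpart of \<open>length_gg_le_iff\<close> for \<open>u\<close>;
    the order of \<open>u\<close> within one length is irrelevant.\<close>
  have count: "leading_pos (u n) \<le> k \<longleftrightarrow> n \<le> length (NN_upto k)" if "n \<ge> 1" for n k
  proof -
    define A where "A = {n. n \<ge> 1 \<and> leading_pos (u n) \<le> k}"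
    \<comment> \<open>Removing leading zeros is injective on \<open>A\<close> since no word recurs
      in \<open>u\<close>, and surjective since every nonzero ZF-word occurs.\<close>
    have bij: "bij_betw (\<lambda>n. dropWhile Not (u n)) A (set (NN_upto k))"
      unfolding bij_betw_def
    proof (intro conjI equalityI subsetI)
      show "inj_on (\<lambda>n. dropWhile Not (u n)) A"
        using unique by (auto simp: inj_on_def A_def same_word_iff)
      show "w \<in> set (NN_upto k)" if w: "w \<in> (\<lambda>n. dropWhile Not (u n)) ` A" for w
      proof -
        from w obtain n where n: "n \<ge> 1" "leading_pos (u n) \<le> k" "w = dropWhile Not (u n)"
          by (auto simp: A_def)
        then have "w \<in> normal_words (leading_pos (u n))"
          using terms[OF n(1)] dropWhile_normal by simp
        then show ?thesis
          using n(2) by (simp add: set_NN_upto normal_words_def)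
      qed
      fix w assume w: "w \<in> set (NN_upto k)"
      then have "w \<noteq> [] \<and> hd w"
        by (simp add: set_NN_upto)
      then obtain x where x: "w = True # x"
        by (auto simp: neq_Nil_conv)
      have "zf_word w" "length w \<le> k"
        using w by (simp_all add: set_NN_upto)
      moreover have "nonzero_word w"
        by (simp add: x nonzero_word_def)
      ultimately obtain n where n: "n \<ge> 1" "same_word (u n) w"
        using once[of w] by blast
      then have "dropWhile Not (u n) = w"
        by (simp add: same_word_iff x)
      moreover from this have "n \<in> A"
        using \<open>length w \<le> k\<close> n(1) terms[OF n(1)] by (simp add: A_def leading_pos_eq)
      ultimately show "w \<in> (\<lambda>n. dropWhile Not (u n)) ` A"
        by blast
    qed
    have card: "card A = length (NN_upto k)" and fin: "finite A"
      using bij_betw_same_card[OF bij] bij_betw_finite[OF bij] distinct_card[OF distinct_NN_upto[of k]]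
      by auto
    \<comment> \<open>Monotonicity makes \<open>A\<close> an initial segment of the positive
      integers, so its size decides membership.\<close>
    have down: "m \<in> A" if "n \<in> A" "1 \<le> m" "m \<le> n" for m n
      using that mono_onD[OF length_increasing, of m n] by (auto simp: A_def)
    have "n \<in> A \<longleftrightarrow> n \<le> card A"
    proof
      assume "n \<in> A"
      then have "{1..n} \<subseteq> A" using down by auto
      from card_mono[OF fin this] show "n \<le> card A" by simp
    next
      assume le: "n \<le> card A"
      show "n \<in> A"
      proof (rule ccontr)
        assume "n \<notin> A"
        then have "m < n" if "m \<in> A" for m
          using down[OF that \<open>n \<ge> 1\<close>] by (meson not_le)
        then have "A \<subseteq> {1..<n}"
          by (auto simp: A_def)
        from card_mono[OF _ this] le that show False by simp
      qed
    qed
    then show ?thesis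
      using that card by (simp add: A_def)
  qed
  \<comment> \<open>Both numbers have the same upper bounds \<open>k\<close>, so they agree.\<close>
  have pos: "leading_pos (u n) = length (gg n)" if "n \<ge> 1" for n
    using count[OF that] length_gg_le_iff[OF that] by (meson order_antisym order_refl)
  fix n :: nat assume n: "n \<ge> 1"
  show "hamming (gg n) (gg (Suc n)) \<le> hamming (u n) (u (Suc n))"
    using gray_step_gg[OF n] unfolding gray_step_def
  proof (elim disjE conjE)
    assume "hamming (gg n) (gg (Suc n)) \<le> 1"
    moreover have "hamming (u n) (u (Suc n)) \<noteq> 0"
      using unique[of n "Suc n"] n same_word_if_hamming_0 by auto
    ultimately show ?thesis by linarith
  next
    assume "length (gg (Suc n)) = Suc (length (gg n))" "hamming (gg n) (gg (Suc n)) \<le> 2"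
    \<comment> \<open>By \<open>pos\<close> the jump in length of \<open>gg\<close> is a jump in
      leading position of \<open>u\<close> at the same index.\<close>
    moreover from this have "2 \<le> hamming (u n) (u (Suc n))"
      using terms[of n] terms[of "Suc n"] pos[of n] pos[of "Suc n"] n by (intro two_le_hamming) auto
    ultimately show ?thesis by linarith
  qed
qed

end
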